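(* Let $n$ be a squarefree positive integer such that every prime divisor of $n$ is at least $7$ and let $p'$ be a prime divisor of $n$. Suppose $\Omega(n)\neq 2$. Then the $C$-extremal sequences for $L(n;p')$ are the same as the $C$-extremal sequences for $U(n)$; that is, a sequence in $\mathbb{Z}_n$ is a $C$-extremal sequence for $L(n;p')$ if and only if it is a $C$-extremal sequence for $U(n)$.
   Context: $\mathbb{Z}_n$ denotes the ring $\mathbb{Z}/n\mathbb{Z}$ and $U(n)$ its group of units. For odd $n$ and $x\in U(n)$, $\left(\frac{x}{n}\right)$ denotes the Jacobi symbol. For a prime divisor $p$ of $n$, $L(n;p)=\{a\in U(n):\left(\frac{a}{n}\right)=\left(\frac{a}{p}\right)\}$. For squarefree $n$, $\Omega(n)$ is the number of prime divisors of $n$. For $A\subseteq\mathbb{Z}_n$, a (nonempty, finite) sequence $(y_1,\ldots,y_k)$ in $\mathbb{Z}_n$ is an $A$-weighted zero-sum sequence if there exist $a_1,\ldots,a_k\in A$ with $a_1y_1+\cdots+a_ky_k=0$. The constant $C_A(n)$ is the least positive integer $k$ such that every sequence of length $k$ in $\mathbb{Z}_n$ has a (nonempty) subsequence of consecutive terms that is an $A$-weighted zero-sum sequence. If $0\notin A$, a $C$-extremal sequence for $A$ is a sequence in $\mathbb{Z}_n$ of length $C_A(n)-1$ which has no $A$-weighted zero-sum subsequence of consecutive terms. *)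

theory Defs
  imports "HOL-Computational_Algebra.Squarefree" "HOL-Number_Theory.Number_Theory" "HOL-Library.Sublist"
begin

text \<open>
  The ring of integers modulo \<open>n\<close> is \<^term>\<open>residue_ring (int n)\<close>, with carrier
  \<open>{0..n - 1}\<close>; it is a ring in the sense of the library for \<open>n > 1\<close>.
\<close>

abbreviation ZMod :: "nat \<Rightarrow> int ring" where
  "ZMod n \<equiv> residue_ring (int n)"

text \<open>The product runs over the multiset of prime factors, i.e. with multiplicity.\<close>

definition Jacobi :: "int \<Rightarrow> nat \<Rightarrow> int" where
  "Jacobi a n = (\<Prod>p\<in>#prime_factorization n. Legendre a (int p))"

definition unit_weights :: "nat \<Rightarrow> int set" where
  "unit_weights n = Units (ZMod n)"

definition L_weights :: "nat \<Rightarrow> nat \<Rightarrow> int set" where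
  "L_weights n p = {a \<in> unit_weights n. Jacobi a n = Legendre a (int p)}"

definition weighted_zero_sum :: "nat \<Rightarrow> int set \<Rightarrow> int list \<Rightarrow> bool" where
  "weighted_zero_sum n A ys \<longleftrightarrow>
     ys \<noteq> [] \<and> set ys \<subseteq> carrier (ZMod n) \<and>
     (\<exists>as. length as = length ys \<and> set as \<subseteq> A \<and>
        (\<Oplus>\<^bsub>ZMod n\<^esub>i\<in>{..<length ys}. as ! i \<otimes>\<^bsub>ZMod n\<^esub> ys ! i) = \<zero>\<^bsub>ZMod n\<^esub>)"

text \<open>\<^const>\<open>sublist\<close> is the library's relation of being a contiguous sublist.\<close>

definition has_consecutive_zero_sum :: "nat \<Rightarrow> int set \<Rightarrow> int list \<Rightarrow> bool" where
  "has_consecutive_zero_sum n A ys \<longleftrightarrow> (\<exists>zs. sublist zs ys \<and> weighted_zero_sum n A zs)"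

text \<open>
  The minimum exists for every nonempty \<open>A\<close> contained in the ring: apply the pigeonhole
  principle to the partial sums of a sequence, using a single constant weight.
\<close>

definition C_const :: "nat \<Rightarrow> int set \<Rightarrow> nat" where
  "C_const n A = (LEAST k. k > 0 \<and>
     (\<forall>ys. length ys = k \<and> set ys \<subseteq> carrier (ZMod n) \<longrightarrow> has_consecutive_zero_sum n A ys))"

text \<open>
  This notion is meant for \<open>A\<close> not containing \<open>0\<close>, which holds for the two
  sets of unit weights above when \<open>n > 1\<close>.
\<close>

definition C_extremal :: "nat \<Rightarrow> int set \<Rightarrow> int list \<Rightarrow> bool" where
  "C_extremal n A ys \<longleftrightarrow>
     set ys \<subseteq> carrier (ZMod n) \<and> length ys = C_const n A - 1 \<and>
     \<not> has_consecutive_zero_sum n A ys"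

end

theory Submission
  imports Defs
begin

text \<open>
  By the Chinese remainder theorem, a sequence is a zero-sum sequence for \<open>U(n)\<close> iff modulo no prime
  divisor of \<open>n\<close> it has exactly one nonzero term. Modulo a prime \<open>p \<ge> 7\<close>, any prescribed quadratic
  characters of the weights can be realised once there are at least three nonzero terms, so a
  zero-sum sequence for \<open>U(n)\<close> can fail to be one for \<open>L(n;p')\<close> only if exactly two terms are units
  modulo \<open>n/p'\<close> and all others vanish modulo \<open>n/p'\<close>. A sequence of length at least
  \<open>2 ^ \<Omega>(n) - 1\<close> with \<open>\<Omega>(n) \<ge> 3\<close> has long stretches of zeros next to such an exception, and these contain
  zero-sum subsequences for \<open>L(n;p')\<close>; hence the two notions of zero-sum-free sequence agree at this length.
\<close>

section \<open>Sums with prescribed quadratic characters\<close>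

lemma Legendre_cong: "[a = b] (mod m) \<Longrightarrow> Legendre a m = Legendre b m"
  by (simp add: Legendre_def QuadRes_def cong_def)

lemma Legendre_eq_0_iff: "Legendre a m = 0 \<longleftrightarrow> m dvd a"
  by (auto simp: Legendre_def cong_0_iff)

lemma Legendre_sign: "\<not> m dvd a \<Longrightarrow> Legendre a m \<in> {1, -1}"
  by (auto simp: Legendre_def cong_0_iff)

lemma Legendre_square: "\<not> m dvd a\<^sup>2 \<Longrightarrow> Legendre (a\<^sup>2) m = 1"
  unfolding Legendre_def cong_0_iff QuadRes_def using cong_refl by metis

context
  fixes p :: nat
  assumes p: "prime p" "2 < p"
begin

private lemma prime_dvd_mult_int_iff: "int p dvd a * b \<longleftrightarrow> int p dvd a \<or> int p dvd b"
  using p by (intro prime_dvd_mult_iff) auto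

text \<open>Euler's criterion makes the two sides congruent modulo \<open>p\<close>; for arguments
  prime to \<open>p\<close> both are signs, so they differ by at most 2, which is less than
  \<open>p\<close>.\<close>

lemma Legendre_mult: "Legendre (a * b) (int p) = Legendre a (int p) * Legendre b (int p)"
proof (cases "int p dvd a * b")
  case True
  then show ?thesis
    by (metis Legendre_eq_0_iff mult_eq_0_iff prime_dvd_mult_int_iff)
next
  case False
  then have nd: "\<not> int p dvd a" "\<not> int p dvd b"
    by auto
  let ?k = "(p - 1) div 2"
  have e: "[Legendre c (int p) = c ^ ?k] (mod int p)" if "\<not> int p dvd c" for c
    using euler_criterion[OF p] that by (simp add: cong_0_iff)
  have "[Legendre a (int p) * Legendre b (int p) = (a * b) ^ ?k] (mod int p)"
    using cong_mult[OF e[OF nd(1)] e[OF nd(2)]] by (simp add: power_mult_distrib)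
  then have "[Legendre (a * b) (int p) = Legendre a (int p) * Legendre b (int p)] (mod int p)"
    using e[OF False] cong_sym cong_trans by blast
  then have "int p dvd Legendre (a * b) (int p) - Legendre a (int p) * Legendre b (int p)"
    by (simp add: cong_iff_dvd_diff)
  moreover have "\<bar>Legendre (a * b) (int p) - Legendre a (int p) * Legendre b (int p)\<bar> < int p"
    using Legendre_sign[OF False] Legendre_sign[OF nd(1)] Legendre_sign[OF nd(2)] p by auto
  ultimately show ?thesis
    using dvd_imp_le_int[of "Legendre (a * b) (int p) - Legendre a (int p) * Legendre b (int p)" "int p"]
    by linarith
qed

text \<open>Squaring identifies 1 and \<open>p - 1\<close>, so on the finite set of nonzero residues
  it is not injective and hence not surjective; any element it misses is a nonresidue.\<close>

lemma exists_nonresidue: "\<exists>a\<in>{1..int p - 1}. Legendre a (int p) = -1"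
proof -
  let ?S = "{1..int p - 1}" and ?f = "\<lambda>x. x\<^sup>2 mod int p"
  have nd: "\<not> int p dvd x" if "x \<in> ?S" for x
    using that zdvd_not_zless[of x "int p"] by auto
  have "?f 1 = ?f (int p - 1)"
  proof -
    have "(int p - 1)\<^sup>2 = 1 + int p * (int p - 2)"
      by (simp add: power2_eq_square algebra_simps)
    then show ?thesis by (metis mod_mult_self2 one_power2)
  qed
  then have "\<not> inj_on ?f ?S"
    using p inj_onD[of ?f ?S 1 "int p - 1"] by auto
  moreover have "?f ` ?S \<subseteq> ?S"
  proof (intro image_subsetI)
    fix x assume "x \<in> ?S"
    then have "\<not> int p dvd x\<^sup>2"
      using nd by (simp add: power2_eq_square prime_dvd_mult_int_iff)
    then have "?f x \<noteq> 0" by (simp add: dvd_eq_mod_eq_0)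
    moreover have "0 \<le> ?f x" "?f x < int p" using p by auto
    ultimately show "?f x \<in> ?S" by simp
  qed
  ultimately have "\<not> ?S \<subseteq> ?f ` ?S"
    using finite_surj_inj[of ?S ?f] by auto
  then obtain a where a: "a \<in> ?S" "a \<notin> ?f ` ?S" by blast
  have "\<not> QuadRes (int p) a"
  proof
    assume "QuadRes (int p) a"
    then obtain y where y: "[y\<^sup>2 = a] (mod int p)" by (auto simp: QuadRes_def)
    then have eq: "?f (y mod int p) = a"
      using a by (simp add: cong_def power_mod)
    then have "y mod int p \<noteq> 0" using a by auto
    moreover have "0 \<le> y mod int p" "y mod int p < int p" using p by auto
    ultimately have "y mod int p \<in> ?S" by simp
    then show False using a eq by (metis imageI)
  qed
  then show ?thesis
    using a nd by (intro bexI[of _ a]) (auto simp: Legendre_def cong_0_iff)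
qed

text \<open>Take the least positive nonresidue \<open>k\<close>: since 1 is a residue,
  \<open>k - 1\<close> is nonzero and, by minimality, a residue.\<close>

lemma nonresidue_after_residue:
  "\<exists>a. Legendre a (int p) = 1 \<and> Legendre (a + 1) (int p) = -1"
proof -
  obtain b where b: "b \<in> {1..int p - 1}" "Legendre b (int p) = -1"
    using exists_nonresidue by blast
  define Q where "Q k \<longleftrightarrow> Legendre (int k) (int p) = -1" for k
  have Qb: "Q (nat b)" using b by (simp add: Q_def)
  define k where "k = (LEAST k. Q k)"
  have Qk: "Q k" unfolding k_def using Qb by (rule LeastI)
  have kb: "k \<le> nat b" unfolding k_def using Qb by (rule Least_le)
  have "\<not> int p dvd 1" using p by auto
  then have L1: "Legendre 1 (int p) = 1" using Legendre_square[of "int p" 1] by simp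
  have "k \<noteq> 0" "k \<noteq> 1"
    using Qk L1 Legendre_eq_0_iff[of 0 "int p"] by (auto simp: Q_def intro!: Nat.gr0I)
  then have k2: "k \<ge> 2" by simp
  have "\<not> Q (k - 1)"
    using k2 not_less_Least[of "k - 1" Q] by (auto simp: k_def)
  moreover have "\<not> int p dvd int (k - 1)"
    using k2 kb b by (intro zdvd_not_zless) auto
  ultimately have "Legendre (int (k - 1)) (int p) = 1"
    using Legendre_sign unfolding Q_def by blast
  moreover have "int (k - 1) + 1 = int k" using k2 by simp
  ultimately show ?thesis using Qk unfolding Q_def by metis
qed

lemma exists_Legendre_eq:
  assumes "e \<in> {1, -1}"
  shows "\<exists>a. Legendre a (int p) = e"
  using nonresidue_after_residue assms by blast

lemma exists_cong_mult:
  assumes "\<not> int p dvd y"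
  shows "\<exists>a. [a * y = b] (mod int p)"
proof -
  have "coprime y (int p)"
    using assms p prime_imp_coprime[of "int p" y] by (simp add: coprime_commute)
  then obtain u where "[y * u = 1] (mod int p)"
    using cong_solve_coprime_int by blast
  then have "[b * (y * u) = b * 1] (mod int p)" by (rule cong_scalar_left)
  then show ?thesis by (intro exI[of _ "b * u"]) (simp add: ac_simps)
qed

text \<open>Multiplicativity forces the character of the solution \<open>a\<close>. This turns a
  choice of the products \<open>a * y\<close> into a choice of weights.\<close>

lemma exists_cong_mult_Legendre:
  assumes "\<not> int p dvd y" "Legendre b (int p) = e * Legendre y (int p)"
  shows "\<exists>a. [a * y = b] (mod int p) \<and> Legendre a (int p) = e"
proof -
  obtain a where a: "[a * y = b] (mod int p)"
    using exists_cong_mult[OF assms(1)] by blast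
  then have "Legendre a (int p) * Legendre y (int p) = e * Legendre y (int p)"
    using Legendre_cong[OF a] assms(2) by (simp add: Legendre_mult)
  then have "Legendre a (int p) = e"
    using assms(1) by (simp add: Legendre_eq_0_iff)
  with a show ?thesis by blast
qed

end

section \<open>Sums with prescribed characters modulo a prime \<open>p \<ge> 7\<close>\<close>

context
  fixes p :: nat
  assumes p: "prime p" "7 \<le> p"
begin

private lemma p2: "2 < p" using p by simp

private lemma Lm: "Legendre (a * b) (int p) = Legendre a (int p) * Legendre b (int p)"
  by (rule Legendre_mult[OF p(1) p2])

text \<open>Guarantees that 9, 16 and 25 are nonzero squares modulo \<open>p\<close> and that a
  factor 3 can be cancelled.\<close>

private lemma not_dvd_primes: "\<not> int p dvd 2" "\<not> int p dvd 3" "\<not> int p dvd 5"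
  using p zdvd_not_zless[of 2 "int p"] zdvd_not_zless[of 3 "int p"] zdvd_not_zless[of 5 "int p"]
  by simp_all

text \<open>The two triples are multiples of \<open>(9, 16, -25)\<close> and of \<open>(1, a, -(a + 1))\<close> for a residue
  \<open>a\<close> followed by a nonresidue; their last characters are opposite.\<close>

private lemma residue_pair_sum:
  assumes "s \<in> {1, -1}"
  shows "\<exists>x y z. Legendre x (int p) = 1 \<and> Legendre y (int p) = 1 \<and> Legendre z (int p) = s \<and>
    x + y + z = 0"
proof -
  have sq: "Legendre 9 (int p) = 1" "Legendre 16 (int p) = 1" "Legendre 25 (int p) = 1"
    "Legendre 1 (int p) = 1"
  proof -
    have l: "Legendre (a * a) (int p) = 1" if "\<not> int p dvd a" for a
      using Legendre_sign[OF that] by (auto simp: Lm)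
    have l2: "Legendre 4 (int p) = 1" using l[of 2] not_dvd_primes by simp
    show "Legendre 9 (int p) = 1" using l[of 3] not_dvd_primes by simp
    show "Legendre 25 (int p) = 1" using l[of 5] not_dvd_primes by simp
    show "Legendre 16 (int p) = 1" using l2 Lm[of 4 4] by simp
    show "Legendre 1 (int p) = 1" using l[of 1] p by simp
  qed
  obtain a where a: "Legendre a (int p) = 1" "Legendre (a + 1) (int p) = -1"
    using nonresidue_after_residue[OF p(1) p2] by blast
  have "Legendre (-1) (int p) \<in> {1, -1}" using p by (intro Legendre_sign) simp
  moreover have "Legendre (-25) (int p) = Legendre (-1) (int p)"
    using Lm[of "-1" 25] sq by simp
  moreover have "Legendre (-(a + 1)) (int p) = - Legendre (-1) (int p)"
    using Lm[of "-1" "a + 1"] a by simp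
  ultimately have "s = Legendre (-25) (int p) \<or> s = Legendre (-(a + 1)) (int p)"
    using assms by auto
  then show ?thesis
  proof
    assume "s = Legendre (-25) (int p)"
    with sq show ?thesis by (intro exI[of _ 9] exI[of _ 16] exI[of _ "-25"]) simp
  next
    assume "s = Legendre (-(a + 1)) (int p)"
    with sq a show ?thesis by (intro exI[of _ 1] exI[of _ a] exI[of _ "-(a+1)"]) simp
  qed
qed

text \<open>Two of the three signs agree, so up to order the signs are \<open>u\<close>,
  \<open>u\<close>, \<open>v\<close>; these come from \<open>residue_pair_sum\<close> with third
  sign \<open>u * v\<close>, scaled by an element of character \<open>u\<close>.\<close>

lemma sum_three_eq_0_Legendre:
  assumes "d \<in> {1, -1}" "e \<in> {1, -1}" "f \<in> {1, -1}"
  shows "\<exists>x y z. Legendre x (int p) = d \<and> Legendre y (int p) = e \<and> Legendre z (int p) = f \<and>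
    x + y + z = 0"
proof -
  have main: "\<exists>x y z. Legendre x (int p) = u \<and> Legendre y (int p) = u \<and> Legendre z (int p) = v \<and>
    x + y + z = 0" if uv: "u \<in> {1, -1}" "v \<in> {1, -1}" for u v
  proof -
    obtain c where c: "Legendre c (int p) = u"
      using exists_Legendre_eq[OF p(1) p2 uv(1)] by blast
    obtain x y z where xyz: "Legendre x (int p) = 1" "Legendre y (int p) = 1"
      "Legendre z (int p) = u * v" "x + y + z = 0"
      using residue_pair_sum[of "u * v"] uv by auto
    have "c * x + c * y + c * z = c * (x + y + z)" by (simp add: algebra_simps)
    then have "c * x + c * y + c * z = 0" using xyz by simp
    moreover have "u * (u * v) = v" using uv by auto
    ultimately show ?thesis
      using c xyz by (intro exI[of _ "c * x"] exI[of _ "c * y"] exI[of _ "c * z"]) (simp add: Lm)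
  qed
  consider "d = e" | "d = f" | "e = f" using assms by auto
  then show ?thesis
  proof cases
    case 1
    then show ?thesis using main assms by blast
  next
    case 2
    obtain x y z where "Legendre x (int p) = d" "Legendre y (int p) = d"
      "Legendre z (int p) = e" "x + y + z = 0" using main assms by blast
    with 2 show ?thesis by (intro exI[of _ x] exI[of _ z] exI[of _ y]) simp
  next
    case 3
    obtain x y z where "Legendre x (int p) = e" "Legendre y (int p) = e"
      "Legendre z (int p) = d" "x + y + z = 0" using main assms by blast
    with 3 show ?thesis by (intro exI[of _ z] exI[of _ x] exI[of _ y]) simp
  qed
qed

text \<open>A vanishing triple whose last entry has the character of \<open>-w\<close> can be scaled
  by an element of character 1 so that this entry becomes \<open>-w\<close>; the other two then sum
  to \<open>w\<close>.\<close>

lemma sum_two_Legendre: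
  assumes "d \<in> {1, -1}" "e \<in> {1, -1}" "\<not> int p dvd w"
  shows "\<exists>x y. Legendre x (int p) = d \<and> Legendre y (int p) = e \<and> [x + y = w] (mod int p)"
proof -
  obtain x y z where xyz: "Legendre x (int p) = d" "Legendre y (int p) = e"
      "Legendre z (int p) = Legendre (-w) (int p)" "x + y + z = 0"
    using sum_three_eq_0_Legendre[OF assms(1,2) Legendre_sign[of "int p" "-w"]] assms(3) by auto
  have "\<not> int p dvd z" using xyz(3) assms(3) by (metis Legendre_eq_0_iff dvd_minus_iff)
  then obtain t where t: "[t * z = -w] (mod int p)" "Legendre t (int p) = 1"
    using exists_cong_mult_Legendre[OF p(1) p2, of z "-w" 1] xyz by auto
  have "t * x + t * y = - (t * z)"
  proof -
    have "t * x + t * y + t * z = t * (x + y + z)" by (simp only: distrib_left)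
    then show ?thesis using xyz(4) by simp
  qed
  moreover have "[- (t * z) = w] (mod int p)"
    using t(1) by (metis cong_minus_minus_iff minus_minus)
  ultimately show ?thesis
    using xyz t(2) by (intro exI[of _ "t * x"] exI[of _ "t * y"]) (simp add: Lm)
qed

lemma sum_three_Legendre:
  assumes "d \<in> {1, -1}" "e \<in> {1, -1}" "f \<in> {1, -1}"
  shows "\<exists>x y z. Legendre x (int p) = d \<and> Legendre y (int p) = e \<and> Legendre z (int p) = f \<and>
    [x + y + z = c] (mod int p)"
proof -
  obtain z0 where z0: "Legendre z0 (int p) = f"
    using exists_Legendre_eq[OF p(1) p2 assms(3)] by blast
  have L4: "Legendre 4 (int p) = 1"
    using Legendre_sign[OF not_dvd_primes(1)] Lm[of 2 2] by auto
  have nd: "\<not> int p dvd z0" using z0 assms(3) by (auto simp flip: Legendre_eq_0_iff)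
  \<comment> \<open>Subtracting a \<open>z\<close> of character \<open>f\<close> reduces to two
    summands unless \<open>c - z\<close> vanishes modulo \<open>p\<close>. Both \<open>z0\<close>
    and \<open>4 * z0\<close> have character \<open>f\<close>, and since they differ by
    \<open>3 * z0\<close>, at least one of them avoids \<open>c\<close>.\<close>
  have "\<not> (int p dvd c - z0 \<and> int p dvd c - 4 * z0)"
  proof
    assume "int p dvd c - z0 \<and> int p dvd c - 4 * z0"
    then have "int p dvd (c - z0) - (c - 4 * z0)" by (blast intro: dvd_diff)
    then have "int p dvd 3 * z0" by simp
    then show False
      using nd not_dvd_primes p prime_dvd_mult_iff[of "int p" 3 z0] by simp
  qed
  then obtain z where z: "Legendre z (int p) = f" "\<not> int p dvd c - z"
    using z0 L4 by (metis Lm mult_1)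
  obtain x y where "Legendre x (int p) = d" "Legendre y (int p) = e"
    "[x + y = c - z] (mod int p)"
    using sum_two_Legendre[OF assms(1,2) z(2)] by blast
  then show ?thesis
    using z by (metis cong_add_rcancel diff_add_cancel)
qed

text \<open>All weights outside \<open>i\<close>, \<open>j\<close>, \<open>k\<close> may be fixed at
  will with the prescribed characters; the three nonzero terms then absorb the remaining sum by
  \<open>sum_three_Legendre\<close>.\<close>

lemma weighted_sum_three_Legendre:
  fixes y :: "'a \<Rightarrow> int"
  assumes "finite I" "i \<in> I" "j \<in> I" "k \<in> I" "i \<noteq> j" "i \<noteq> k" "j \<noteq> k"
    and y: "\<not> int p dvd y i" "\<not> int p dvd y j" "\<not> int p dvd y k"
    and e: "\<And>t. e t \<in> {1, -1}"
  shows "\<exists>a. (\<forall>t\<in>I. Legendre (a t) (int p) = e t) \<and> int p dvd (\<Sum>t\<in>I. a t * y t)"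
proof -
  have "\<forall>t. \<exists>a. Legendre a (int p) = e t"
    using exists_Legendre_eq[OF p(1) p2 e] by (rule allI)
  then obtain b where b: "\<And>t. Legendre (b t) (int p) = e t" by metis
  let ?J = "I - {i} - {j} - {k}"
  \<comment> \<open>The signs asked of the products are those of weight times term, so that dividing
    by the term leaves a weight of character \<open>e\<close>.\<close>
  have s: "e t * Legendre (y t) (int p) \<in> {1, -1}" if "\<not> int p dvd y t" for t
    using e[of t] Legendre_sign[OF that] by auto
  obtain u v w where uvw: "Legendre u (int p) = e i * Legendre (y i) (int p)"
    "Legendre v (int p) = e j * Legendre (y j) (int p)"
    "Legendre w (int p) = e k * Legendre (y k) (int p)"
    "[u + v + w = - (\<Sum>t\<in>?J. b t * y t)] (mod int p)"
    using sum_three_Legendre[OF s[OF y(1)] s[OF y(2)] s[OF y(3)]] by blast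
  note solve = exists_cong_mult_Legendre[OF p(1) p2]
  obtain u' where u': "[u' * y i = u] (mod int p)" "Legendre u' (int p) = e i"
    using solve[OF y(1) uvw(1)] by blast
  obtain v' where v': "[v' * y j = v] (mod int p)" "Legendre v' (int p) = e j"
    using solve[OF y(2) uvw(2)] by blast
  obtain w' where w': "[w' * y k = w] (mod int p)" "Legendre w' (int p) = e k"
    using solve[OF y(3) uvw(3)] by blast
  define a where "a = b(i := u', j := v', k := w')"
  have a: "a i = u'" "a j = v'" "a k = w'"
    using assms(5-7) by (simp_all add: a_def)
  have aJ: "a t = b t" if "t \<in> ?J" for t
    using that by (simp add: a_def)
  have "(\<Sum>t\<in>I. a t * y t) = a i * y i + (\<Sum>t\<in>I - {i}. a t * y t)"
    using assms(1,2) by (rule sum.remove)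
  also have "(\<Sum>t\<in>I - {i}. a t * y t) = a j * y j + (\<Sum>t\<in>I - {i} - {j}. a t * y t)"
    using assms(1-7) by (intro sum.remove) auto
  also have "(\<Sum>t\<in>I - {i} - {j}. a t * y t) = a k * y k + (\<Sum>t\<in>?J. a t * y t)"
    using assms(1-7) by (intro sum.remove) auto
  also have "(\<Sum>t\<in>?J. a t * y t) = (\<Sum>t\<in>?J. b t * y t)"
    by (intro sum.cong) (simp_all only: aJ)
  finally have eq: "(\<Sum>t\<in>I. a t * y t) = (u' * y i + v' * y j + w' * y k) + (\<Sum>t\<in>?J. b t * y t)"
    using a by (simp only: add.assoc)
  have "[u' * y i + v' * y j + w' * y k = - (\<Sum>t\<in>?J. b t * y t)] (mod int p)"
    using cong_add[OF cong_add[OF u'(1) v'(1)] w'(1)] uvw(4) cong_trans by blast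
  then have "int p dvd (\<Sum>t\<in>I. a t * y t)"
    unfolding eq by (simp add: cong_iff_dvd_diff)
  moreover have "\<forall>t\<in>I. Legendre (a t) (int p) = e t"
    using b u' v' w' by (simp add: a_def)
  ultimately show ?thesis by blast
qed

end

text \<open>With two nonzero terms, the weight at \<open>j\<close> determines the one at
  \<open>i\<close> modulo \<open>p\<close>; the latter is a unit, but its character cannot be
  prescribed as well.\<close>

lemma weighted_sum_two_Legendre:
  fixes y :: "'a \<Rightarrow> int" and p :: nat
  assumes p: "prime p" "2 < p" and "finite I" "i \<in> I" "j \<in> I" "i \<noteq> j"
    and y: "\<not> int p dvd y i" "\<not> int p dvd y j"
    and z: "\<And>t. t \<in> I \<Longrightarrow> t \<noteq> i \<Longrightarrow> t \<noteq> j \<Longrightarrow> int p dvd y t"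
    and e: "\<And>t. e t \<in> {1, -1}"
  shows "\<exists>a. (\<forall>t\<in>I. \<not> int p dvd a t) \<and> (\<forall>t\<in>I - {i}. Legendre (a t) (int p) = e t) \<and>
    int p dvd (\<Sum>t\<in>I. a t * y t)"
proof -
  have "\<forall>t. \<exists>a. Legendre a (int p) = e t"
    using exists_Legendre_eq[OF p e] by (rule allI)
  then obtain b where b: "\<And>t. Legendre (b t) (int p) = e t" by metis
  have nb: "\<not> int p dvd b t" for t
    using b[of t] e[of t] by (auto simp flip: Legendre_eq_0_iff)
  let ?J = "I - {i} - {j}"
  obtain u where u: "[u * y i = - (b j * y j)] (mod int p)"
    using exists_cong_mult[OF p y(1)] by blast
  have "\<not> int p dvd b j * y j"
    using nb y p by (simp add: prime_dvd_mult_iff)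
  then have nu: "\<not> int p dvd u"
    using cong_dvd_iff[OF u] by auto
  define a where "a = b(i := u)"
  have a: "a i = u" "a j = b j"
    using assms(6) by (simp_all add: a_def)
  have "(\<Sum>t\<in>I. a t * y t) = a i * y i + (\<Sum>t\<in>I - {i}. a t * y t)"
    using assms(3,4) by (rule sum.remove)
  also have "(\<Sum>t\<in>I - {i}. a t * y t) = a j * y j + (\<Sum>t\<in>?J. a t * y t)"
    using assms(3-6) by (intro sum.remove) auto
  finally have "(\<Sum>t\<in>I. a t * y t) = (u * y i + b j * y j) + (\<Sum>t\<in>?J. a t * y t)"
    using a by (simp only: add.assoc)
  moreover have "int p dvd (\<Sum>t\<in>?J. a t * y t)"
    using z by (intro dvd_sum) (simp add: dvd_mult)
  moreover have "int p dvd u * y i + b j * y j"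
    using u by (simp add: cong_iff_dvd_diff)
  ultimately have "int p dvd (\<Sum>t\<in>I. a t * y t)"
    by simp
  moreover have "\<forall>t\<in>I. \<not> int p dvd a t" "\<forall>t\<in>I - {i}. Legendre (a t) (int p) = e t"
    using b nb nu by (simp_all add: a_def)
  ultimately show ?thesis by blast
qed

section \<open>Nonzero terms modulo a set of primes\<close>

definition nonzero_count :: "nat \<Rightarrow> int list \<Rightarrow> nat" where
  "nonzero_count p ys = length (filter (\<lambda>y. \<not> int p dvd y) ys)"

text \<open>For the set of prime divisors of \<open>n\<close> this becomes the criterion
  \<open>weighted_zero_sum_unit_iff\<close>. An arbitrary set \<open>P\<close> allows induction by
  removing a prime.\<close>

definition balanced :: "nat set \<Rightarrow> int list \<Rightarrow> bool" where
  "balanced P ys \<longleftrightarrow> ys \<noteq> [] \<and> (\<forall>p\<in>P. nonzero_count p ys \<noteq> 1)"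

lemma nonzero_count_append [simp]:
  "nonzero_count p (xs @ ys) = nonzero_count p xs + nonzero_count p ys"
  by (simp add: nonzero_count_def)

lemma nonzero_count_Cons [simp]:
  "nonzero_count p (y # ys) = (if int p dvd y then 0 else 1) + nonzero_count p ys"
  by (simp add: nonzero_count_def)

lemma nonzero_count_Nil [simp]: "nonzero_count p [] = 0"
  by (simp add: nonzero_count_def)

lemma nonzero_count_eq_0_iff: "nonzero_count p ys = 0 \<longleftrightarrow> (\<forall>y\<in>set ys. int p dvd y)"
  by (auto simp: nonzero_count_def filter_empty_conv)

lemma nonzero_count_sublist_le: "sublist zs ys \<Longrightarrow> nonzero_count p zs \<le> nonzero_count p ys"
  by (auto simp: sublist_def)

lemma nonzero_count_SucE:
  assumes "nonzero_count p ys = Suc m"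
  obtains us x vs where "ys = us @ x # vs" "\<not> int p dvd x" "nonzero_count p us = 0"
    "nonzero_count p vs = m"
proof -
  obtain x xs where "filter (\<lambda>y. \<not> int p dvd y) ys = x # xs"
    using assms by (auto simp: nonzero_count_def length_Suc_conv)
  then obtain us vs where "ys = us @ x # vs" "\<forall>u\<in>set us. int p dvd u" "\<not> int p dvd x"
    by (auto simp: filter_eq_Cons_iff)
  then show thesis
    using assms that by (auto simp: nonzero_count_eq_0_iff[THEN iffD2])
qed

text \<open>Separates the sublists that contain the marked term \<open>x\<close> from the others. In
  the applications \<open>x\<close> is the only term that is nonzero modulo a certain prime, so a
  sublist through it is not balanced.\<close>

lemma sublist_append_ConsE:
  assumes "sublist zs (us @ x # vs)"
  obtains "sublist zs us" | "sublist zs vs" | as bs where "zs = as @ x # bs" "suffix as us" "prefix bs vs"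
proof -
  consider "sublist zs us" | "sublist zs (x # vs)"
    | as cs where "zs = as @ cs" "suffix as us" "prefix cs (x # vs)"
    using assms by (auto simp: sublist_append)
  then show thesis
  proof cases
    case 1
    then show thesis by (rule that(1))
  next
    case 2
    then consider "sublist zs vs" | "zs = []" | bs where "zs = x # bs" "prefix bs vs"
      by (auto simp: sublist_Cons_right prefix_Cons)
    then show thesis
      by cases (use that(1,2) that(3)[of "[]"] in auto)
  next
    case 3
    then consider "cs = []" | bs where "cs = x # bs" "prefix bs vs"
      by (auto simp: prefix_Cons)
    then show thesis
      using 3 that(1) that(3)[of as] by cases auto
  qed
qed

section \<open>Balanced sublists and their extremal lengths\<close>

lemma balanced_add_zero:
  assumes "balanced Q zs" "sublist zs ys" "\<And>p. p \<in> P - Q \<Longrightarrow> nonzero_count p ys = 0"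
  shows "balanced P zs"
  using assms nonzero_count_sublist_le[OF assms(2)] unfolding balanced_def
  by (metis DiffI le_zero_eq zero_neq_one)

text \<open>Induction on the number of primes. In an unbalanced list some \<open>p\<close> has a
  single nonzero term; deleting it leaves two stretches divisible by \<open>p\<close>, one of them
  of length at least \<open>2 ^ (card P - 1)\<close>, to which the induction hypothesis for
  \<open>P - {p}\<close> applies.\<close>

lemma exists_balanced_sublist:
  assumes "finite P" "2 ^ card P \<le> length ys"
  shows "\<exists>zs. sublist zs ys \<and> balanced P zs"
  using assms
proof (induction "card P" arbitrary: P ys rule: less_induct)
  case less
  have ne: "ys \<noteq> []" using less.prems by (cases ys) auto
  show ?case
  proof (cases "balanced P ys")
    case True
    then show ?thesis by blast
  next
    case False
    then obtain p where p: "p \<in> P" "nonzero_count p ys = Suc 0"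
      using ne by (auto simp: balanced_def)
    obtain us x vs where ys: "ys = us @ x # vs" "nonzero_count p us = 0" "nonzero_count p vs = 0"
      using p(2) by (rule nonzero_count_SucE)
    have lt: "card (P - {p}) < card P" and fin: "finite (P - {p})"
      using card_Diff1_less[OF less.prems(1) p(1)] less.prems(1) by simp_all
    have "card P = Suc (card (P - {p}))"
      using less.prems p by (intro card.remove)
    then have "2 ^ card (P - {p}) \<le> length us \<or> 2 ^ card (P - {p}) \<le> length vs"
      using less.prems ys(1) by auto
    then obtain ws where ws: "ws = us \<or> ws = vs" "2 ^ card (P - {p}) \<le> length ws" by blast
    obtain zs where zs: "sublist zs ws" "balanced (P - {p}) zs"
      using less.hyps[OF lt fin ws(2)] by blast
    have "nonzero_count q ws = 0" if "q \<in> P - (P - {p})" for q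
      using that ws ys by auto
    then have "balanced P zs" by (rule balanced_add_zero[OF zs(2,1)])
    moreover have "sublist ws ys"
      using ws ys(1) sublist_appendI[of vs "us @ [x]" "[]"] by auto
    ultimately show ?thesis using zs(1) sublist_order.order.trans by blast
  qed
qed

text \<open>Doubling construction showing that \<open>2 ^ card P\<close> is sharp: two copies of a
  list for \<open>P\<close>, multiplied by the new prime \<open>p\<close>, surround the product of
  \<open>P\<close>. A sublist through the middle has one nonzero term modulo \<open>p\<close>; any
  other lies in a copy, where multiplication by \<open>p\<close> did not change the counts for
  \<open>P\<close>.\<close>

lemma exists_list_without_balanced_sublist:
  assumes "finite P" "\<And>p. p \<in> P \<Longrightarrow> prime p"
  shows "\<exists>ys. length ys = 2 ^ card P - 1 \<and> (\<forall>zs. sublist zs ys \<longrightarrow> \<not> balanced P zs)"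
  using assms
proof (induction P rule: finite_induct)
  case empty
  show ?case by (simp add: balanced_def)
next
  case (insert p P)
  then obtain ys where ys: "length ys = 2 ^ card P - 1" "\<And>zs. sublist zs ys \<Longrightarrow> \<not> balanced P zs"
    by auto
  let ?ms = "map ((*) (int p)) ys" and ?x = "int (\<Prod>P)"
  have p: "prime p" and P: "\<And>q. q \<in> P \<Longrightarrow> prime q"
    using insert.prems by auto
  have x: "\<not> int p dvd ?x"
  proof
    assume "int p dvd ?x"
    then have "p dvd \<Prod>P" by (simp only: int_dvd_int_iff)
    then obtain q where "q \<in> P" "p dvd q"
      using p insert.hyps(1) by (auto simp: prime_dvd_prod_iff)
    then show False using P p insert.hyps(2) primes_dvd_imp_eq by blast
  qed
  have cnt: "nonzero_count q (map ((*) (int p)) zs) = nonzero_count q zs" if "q \<in> P" for q zs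
  proof -
    have "\<not> q dvd p" using that P p insert.hyps(2) primes_dvd_imp_eq by blast
    then have "int q dvd int p * y \<longleftrightarrow> int q dvd y" for y
      using P[OF that] by (simp add: prime_dvd_mult_iff)
    then show ?thesis by (induction zs) auto
  qed
  have no: "\<not> balanced (insert p P) zs" if "sublist zs ?ms" for zs
  proof
    assume b: "balanced (insert p P) zs"
    from sublist_map_rightE[OF that]
    obtain zs' where zs': "zs = map ((*) (int p)) zs'" "sublist zs' ys" by blast
    then have "balanced P zs'"
      using b cnt by (auto simp: balanced_def)
    then show False using ys(2) zs' by blast
  qed
  have zero: "nonzero_count p zs = 0" if "sublist zs ?ms" for zs
    using set_mono_sublist[OF that] by (auto simp: nonzero_count_eq_0_iff)
  have "\<not> balanced (insert p P) zs" if "sublist zs (?ms @ ?x # ?ms)" for zs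
    using that
  proof (rule sublist_append_ConsE)
    fix as bs assume zs: "zs = as @ ?x # bs" and "suffix as ?ms" "prefix bs ?ms"
    then have "nonzero_count p zs = 1" using x zero[of as] zero[of bs] by simp
    then show ?thesis by (simp add: balanced_def)
  qed (use no in auto)
  moreover have "length (?ms @ ?x # ?ms) = 2 ^ card (insert p P) - 1"
  proof -
    have "length (?ms @ ?x # ?ms) = 2 * length ys + 1" by simp
    moreover have "(2::nat) ^ card (insert p P) = 2 * 2 ^ card P"
      using insert.hyps by simp
    moreover have "(2::nat) ^ card P \<ge> 1" by simp
    ultimately show ?thesis using ys(1) by linarith
  qed
  ultimately show ?case by blast
qed

text \<open>A balanced list that is not a zero-sum sequence for \<open>L(n; r)\<close> satisfies the conclusions of
  \<open>two\<close> and \<open>same\<close>.\<close>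

lemma no_balanced_sublist:
  assumes fin: "finite P" and r: "r \<in> P" and k: "3 \<le> card P"
    and len: "2 ^ card P - 1 \<le> length ys"
    and two: "\<And>zs q. sublist zs ys \<Longrightarrow> balanced P zs \<Longrightarrow> q \<in> P - {r} \<Longrightarrow> nonzero_count q zs = 2"
    and same: "\<And>zs q q' y. sublist zs ys \<Longrightarrow> balanced P zs \<Longrightarrow> q \<in> P - {r} \<Longrightarrow> q' \<in> P - {r} \<Longrightarrow>
      y \<in> set zs \<Longrightarrow> int q dvd y \<Longrightarrow> int q' dvd y"
    and sub: "sublist zs ys"
  shows "\<not> balanced P zs"
proof
  assume bal: "balanced P zs"
  define m where "m = card (P - {r})"
  have km: "card P = Suc m" using card.remove[OF fin r] by (simp add: m_def)
  then have m2: "2 \<le> m" using k by simp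
  then have pow: "(4::nat) \<le> 2 ^ m" using power_increasing[of 2 m "2::nat"] by simp
  obtain q0 where q0: "q0 \<in> P - {r}"
    using m2 unfolding m_def by (metis card.empty ex_in_conv not_numeral_le_zero)
  \<comment> \<open>A sublist has at most as many nonzero terms as the whole, so a count of 1 at a
    prime other than \<open>r\<close> rules out the count 2 that \<open>two\<close> requires of a
    balanced sublist.\<close>
  have unique: False if "p \<in> P - {r}" "nonzero_count p ws = 1" "sublist ws ys" "sublist ts ws" "balanced P ts"
    for p ws ts
    using two[of ts p] that nonzero_count_sublist_le[of ts ws p] sublist_order.order.trans by fastforce
  \<comment> \<open>If \<open>ys\<close> were balanced, its two nonzero terms modulo
    \<open>q0\<close> would cut it into three stretches, one of length at least 2. By
    \<open>same\<close> that stretch vanishes modulo every prime except possibly \<open>r\<close>,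
    so a sublist balanced for \<open>{r}\<close> alone is balanced for \<open>P\<close>; but its
    count at \<open>q0\<close> is 0 instead of 2.\<close>
  have "\<not> balanced P ys"
  proof
    assume b: "balanced P ys"
    have "nonzero_count q0 ys = Suc (Suc 0)"
      using two[OF _ b q0] by simp
    then obtain us x vs' where 1: "ys = us @ x # vs'" "nonzero_count q0 us = 0" "nonzero_count q0 vs' = Suc 0"
      by (rule nonzero_count_SucE)
    from 1(3) obtain vs y ws where 2: "vs' = vs @ y # ws" "nonzero_count q0 vs = 0" "nonzero_count q0 ws = 0"
      by (rule nonzero_count_SucE)
    have "length ys \<ge> 7" using len km pow by simp
    then have "2 \<le> length us \<or> 2 \<le> length vs \<or> 2 \<le> length ws"
      using 1(1) 2(1) by auto
    moreover have "sublist us ys" "sublist vs ys" "sublist ws ys"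
      unfolding 1(1) 2(1) sublist_def by (metis append.left_neutral append_assoc append_Cons append_Nil2)+
    ultimately obtain ts where ts: "2 \<le> length ts" "sublist ts ys" "nonzero_count q0 ts = 0"
      using 1 2 by metis
    then obtain zs where zs: "sublist zs ts" "balanced {r} zs"
      using exists_balanced_sublist[of "{r}" ts] by auto
    have "nonzero_count q ts = 0" if "q \<in> P - {r}" for q
      using ts(3) set_mono_sublist[OF ts(2)] same[OF _ b q0 that]
      by (auto simp: nonzero_count_eq_0_iff)
    then have "balanced P zs" by (rule balanced_add_zero[OF zs(2,1)])
    then have "nonzero_count q0 zs = 2"
      using two q0 zs(1) ts(2) sublist_order.order.trans by blast
    then show False using nonzero_count_sublist_le[OF zs(1), of q0] ts(3) by simp
  qed
  moreover have "ys \<noteq> []" using len km pow by auto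
  ultimately obtain p where p: "p \<in> P" "nonzero_count p ys = 1"
    by (auto simp: balanced_def)
  \<comment> \<open>By \<open>unique\<close> the only prime of count 1 is \<open>r\<close>, so
    \<open>ys\<close> splits at a term \<open>x\<close> into two stretches divisible by
    \<open>r\<close>.\<close>
  then have "p = r" using unique[of p ys zs] sub bal by auto
  with p(2) have "nonzero_count r ys = Suc 0" by simp
  then obtain us x vs where ys: "ys = us @ x # vs" "\<not> int r dvd x"
    "nonzero_count r us = 0" "nonzero_count r vs = 0"
    by (rule nonzero_count_SucE)
  have uv: "sublist us ys" "sublist vs ys"
    using ys(1) sublist_appendI[of vs "us @ [x]" "[]"] by auto
  \<comment> \<open>A balanced \<open>ws\<close> of length at least 3 would contain a term divisible
    by \<open>q0\<close>, hence by \<open>same\<close> and the assumption on \<open>r\<close> by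
    every prime of \<open>P\<close>; taken alone, this term would be balanced with count 0 at
    \<open>q0\<close>. If \<open>ws\<close> is not balanced, \<open>unique\<close> excludes balanced
    sublists.\<close>
  have side: "\<not> balanced P ts"
    if ws: "3 \<le> length ws" "sublist ws ys" "nonzero_count r ws = 0" and ts: "sublist ts ws" for ws ts
  proof
    assume b: "balanced P ts"
    have "\<not> balanced P ws"
    proof
      assume bw: "balanced P ws"
      then have "nonzero_count q0 ws < length ws" using two[OF ws(2) bw q0] ws(1) by simp
      then obtain y where y: "y \<in> set ws" "int q0 dvd y"
        unfolding nonzero_count_def by (metis (mono_tags, lifting) filter_True less_irrefl)
      have "int q dvd y" if "q \<in> P" for q
        using same[OF ws(2) bw q0 _ y] ws(3) y(1) that by (cases "q = r") (auto simp: nonzero_count_eq_0_iff)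
      then have "balanced P [y]" by (auto simp: balanced_def)
      moreover have "sublist [y] ws"
        using split_list[OF y(1)] by (auto simp: sublist_def)
      ultimately have "nonzero_count q0 [y] = 2"
        using two q0 ws(2) sublist_order.order.trans by blast
      then show False using y(2) by simp
    qed
    then obtain p where "p \<in> P" "nonzero_count p ws = 1"
      using ws(1) by (auto simp: balanced_def)
    moreover from this have "p \<noteq> r" using ws(3) by auto
    ultimately show False using unique[of p ws ts] ws ts b by blast
  qed
  \<comment> \<open>On a stretch divisible by \<open>r\<close> only the \<open>m\<close> other
    primes matter, so length \<open>2 ^ m\<close> would give a balanced sublist, against
    \<open>side\<close>.\<close>
  have bound: "length ws < 2 ^ m" if ws: "sublist ws ys" "nonzero_count r ws = 0" for ws
  proof (rule ccontr)
    assume "\<not> length ws < 2 ^ m"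
    then have l: "2 ^ card (P - {r}) \<le> length ws" by (simp add: m_def)
    have "finite (P - {r})" using fin by simp
    from exists_balanced_sublist[OF this l]
    obtain ts where ts: "sublist ts ws" "balanced (P - {r}) ts" by blast
    have "nonzero_count q ws = 0" if "q \<in> P - (P - {r})" for q
      using that ws(2) by simp
    then have "balanced P ts" by (rule balanced_add_zero[OF ts(2,1)])
    moreover have "3 \<le> length ws" using l pow by (simp add: m_def)
    ultimately show False using side[OF _ ws ts(1)] by blast
  qed
  \<comment> \<open>Each stretch is shorter than \<open>2 ^ m\<close>, while both together have at
    least \<open>2 * 2 ^ m - 2\<close> terms; so each has at least \<open>2 ^ m - 1 \<ge> 3\<close>
    terms and \<open>side\<close> applies to both.\<close>
  have "length us + length vs + 2 \<ge> 2 * 2 ^ m"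
    using len km ys(1) by simp
  moreover have "length us < 2 ^ m" "length vs < 2 ^ m"
    using bound uv ys by auto
  ultimately have l3: "3 \<le> length us" "3 \<le> length vs" using pow by linarith+
  have "sublist zs (us @ x # vs)" using sub ys(1) by simp
  then show False
  proof (rule sublist_append_ConsE)
    assume "sublist zs us"
    then show False using side[OF l3(1) uv(1) ys(3)] bal by blast
  next
    assume "sublist zs vs"
    then show False using side[OF l3(2) uv(2) ys(4)] bal by blast
  next
    fix as bs assume zs: "zs = as @ x # bs" and ab: "suffix as us" "prefix bs vs"
    have "nonzero_count r as \<le> 0" "nonzero_count r bs \<le> 0"
      using nonzero_count_sublist_le[of as us r] nonzero_count_sublist_le[of bs vs r] ab ys(3,4) by auto
    then have "nonzero_count r zs = 1" using zs ys(2) by simp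
    then show False using bal r by (auto simp: balanced_def)
  qed
qed

section \<open>Weighted zero-sum sequences over squarefree moduli\<close>

lemma prime_factorization_squarefree:
  fixes n :: nat
  assumes "squarefree n"
  shows "prime_factorization n = mset_set (prime_factors n)"
proof (rule multiset_eqI)
  fix p
  have "n \<noteq> 0" using assms by (metis not_squarefree_0)
  show "count (prime_factorization n) p = count (mset_set (prime_factors n)) p"
  proof (cases "p \<in> prime_factors n")
    case True
    then have "prime p" by auto
    then have "multiplicity p n \<le> 1"
      using assms \<open>n \<noteq> 0\<close> by (simp add: squarefree_factorial_semiring'')
    moreover have "0 < count (prime_factorization n) p" using True by simp
    ultimately show ?thesis using True \<open>prime p\<close> by (simp add: count_prime_factorization)
  next
    case False
    then show ?thesis by (simp add: not_in_iff)
  qed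
qed

lemma Jacobi_squarefree:
  "squarefree n \<Longrightarrow> Jacobi a n = (\<Prod>p\<in>prime_factors n. Legendre a (int p))"
  unfolding Jacobi_def prod_unfold_prod_mset by (simp only: flip: prime_factorization_squarefree)

lemma prod_primes_dvd:
  assumes "finite P" "\<And>p. p \<in> P \<Longrightarrow> prime p" "\<And>p. p \<in> P \<Longrightarrow> int p dvd z"
  shows "int (\<Prod>P) dvd z"
  using assms
proof (induction P rule: finite_induct)
  case (insert p P)
  have "coprime p (\<Prod>P)"
    using insert.prems insert.hyps by (intro prod_coprime_right) (auto intro: primes_coprime)
  then have "coprime (int p) (int (\<Prod>P))" by (simp only: coprime_int_iff)
  then have "int p * int (\<Prod>P) dvd z"
    using insert.prems insert.IH by (intro divides_mult) auto
  then show ?case using insert.hyps by simp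
qed simp

lemma prod_prime_factors_squarefree:
  fixes n :: nat
  assumes "squarefree n"
  shows "\<Prod>(prime_factors n) = n"
proof -
  have "n \<noteq> 0" using assms by (metis not_squarefree_0)
  then have "n = prod_mset (prime_factorization n)"
    by (simp add: prod_mset_prime_factorization_nat)
  also have "\<dots> = prod_mset (mset_set (prime_factors n))"
    using prime_factorization_squarefree[OF assms] by (rule arg_cong)
  also have "\<dots> = \<Prod>(prime_factors n)"
    by (simp add: prod_unfold_prod_mset)
  finally show ?thesis by (rule sym)
qed

lemma squarefree_dvdI:
  assumes "squarefree n" "\<And>p. p \<in> prime_factors n \<Longrightarrow> int p dvd z"
  shows "int n dvd z"
  using prod_primes_dvd[of "prime_factors n" z] assms(2)
  by (simp add: prod_prime_factors_squarefree[OF assms(1)] in_prime_factors_imp_prime)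

lemma squarefree_coprimeI:
  assumes "squarefree n" "\<And>p. p \<in> prime_factors n \<Longrightarrow> \<not> int p dvd x"
  shows "coprime x (int n)"
proof -
  have "coprime x (int p)" if "p \<in> prime_factors n" for p
  proof -
    have "prime (int p)" using that by auto
    then show ?thesis
      using assms(2)[OF that] prime_imp_coprime[of "int p" x] coprime_commute[of x "int p"] by blast
  qed
  then have "coprime x (\<Prod>p\<in>prime_factors n. int p)"
    by (rule prod_coprime_right)
  moreover have "(\<Prod>p\<in>prime_factors n. int p) = int n"
    unfolding of_nat_prod[symmetric] prod_prime_factors_squarefree[OF assms(1)] ..
  ultimately show ?thesis by simp
qed

lemma prime_factors_remainder:
  fixes n :: nat and b :: "nat \<Rightarrow> int"
  assumes "0 < n"
  shows "\<exists>x\<in>{0..<int n}. \<forall>p\<in>prime_factors n. [x = b p] (mod int p)"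
proof -
  have "\<forall>p\<in>prime_factors n. \<forall>q\<in>prime_factors n. p \<noteq> q \<longrightarrow> coprime p q"
    by (auto intro: primes_coprime)
  then obtain y where y: "\<forall>p\<in>prime_factors n. [y = nat (b p mod int p)] (mod p)"
    using chinese_remainder_nat[of "prime_factors n" "\<lambda>p. p" "\<lambda>p. nat (b p mod int p)"] by auto
  have "[int (y mod n) = b p] (mod int p)" if p: "p \<in> prime_factors n" for p
  proof -
    have "p > 0" "p dvd n" using p by (auto intro: prime_gt_0_nat)
    then have "[y mod n = nat (b p mod int p)] (mod p)"
      using y p by (simp add: cong_def mod_mod_cancel)
    then have "[int (y mod n) = int (nat (b p mod int p))] (mod int p)"
      by (simp only: cong_int_iff)
    then show ?thesis using \<open>p > 0\<close> by (simp add: cong_def)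
  qed
  then show ?thesis using assms by (intro bexI[of _ "int (y mod n)"]) auto
qed

context
  fixes n :: nat
  assumes n: "1 < n"
begin

lemma unit_weights_eq: "unit_weights n = {x. 0 < x \<and> x < int n \<and> coprime x (int n)}"
proof -
  interpret residues "int n" "ZMod n" by unfold_locales (use n in auto)
  show ?thesis unfolding unit_weights_def by (rule res_units_eq)
qed

text \<open>Replaces the sum in the ring by divisibility of an integer sum, which can be tested
  prime by prime.\<close>

lemma weighted_zero_sum_iff:
  "weighted_zero_sum n A ys \<longleftrightarrow> ys \<noteq> [] \<and> set ys \<subseteq> carrier (ZMod n) \<and>
     (\<exists>as. length as = length ys \<and> set as \<subseteq> A \<and> int n dvd (\<Sum>i<length ys. as ! i * ys ! i))"
proof -
  interpret residues "int n" "ZMod n" by unfold_locales (use n in auto)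
  have "(\<Oplus>\<^bsub>ZMod n\<^esub>i\<in>{..<length ys}. as ! i \<otimes>\<^bsub>ZMod n\<^esub> ys ! i) =
      (\<Sum>i<length ys. as ! i * ys ! i) mod int n" for as
    unfolding res_mult_eq by (rule sum_cong) simp
  then show ?thesis
    by (simp add: weighted_zero_sum_def res_zero_eq dvd_eq_mod_eq_0)
qed

end

lemma weighted_zero_sum_mono:
  "A \<subseteq> B \<Longrightarrow> weighted_zero_sum n A ys \<Longrightarrow> weighted_zero_sum n B ys"
  unfolding weighted_zero_sum_def by (meson order_trans)

lemma has_consecutive_zero_sum_mono:
  "A \<subseteq> B \<Longrightarrow> has_consecutive_zero_sum n A ys \<Longrightarrow> has_consecutive_zero_sum n B ys"
  unfolding has_consecutive_zero_sum_def using weighted_zero_sum_mono by blast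

text \<open>Weights modulo one prime are arbitrary integers indexed by position; reduction modulo
  \<open>n\<close> is left to the gluing in \<open>local_to_global_weights\<close>, and characters
  are tracked separately.\<close>

definition local_weights :: "nat \<Rightarrow> int list \<Rightarrow> (nat \<Rightarrow> int) \<Rightarrow> bool" where
  "local_weights p ys a \<longleftrightarrow>
     (\<forall>t<length ys. \<not> int p dvd a t) \<and> int p dvd (\<Sum>t<length ys. a t * ys ! t)"

section \<open>Choosing weights modulo one prime\<close>

lemma nonzero_count_conv_card:
  "nonzero_count p ys = card {t. t < length ys \<and> \<not> int p dvd ys ! t}"
  by (simp add: nonzero_count_def length_filter_conv_card)

text \<open>With no nonzero term the sum vanishes for all weights; with at least three,
  \<open>weighted_sum_three_Legendre\<close> applies.\<close>

lemma local_weights_prescribed: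
  assumes p: "prime p" "7 \<le> p" and c: "nonzero_count p ys \<notin> {1, 2}"
    and e: "\<And>t. e t \<in> {1, -1}"
  shows "\<exists>a. local_weights p ys a \<and> (\<forall>t<length ys. Legendre (a t) (int p) = e t)"
proof -
  let ?S = "{t. t < length ys \<and> \<not> int p dvd ys ! t}"
  have "\<exists>a. (\<forall>t\<in>{..<length ys}. Legendre (a t) (int p) = e t) \<and>
      int p dvd (\<Sum>t<length ys. a t * ys ! t)"
  proof (cases "nonzero_count p ys = 0")
    case True
    have "\<forall>t. \<exists>a. Legendre a (int p) = e t"
      using exists_Legendre_eq[OF p(1) _ e] p(2) by simp
    then obtain a where "\<And>t. Legendre (a t) (int p) = e t" by metis
    moreover have "int p dvd (\<Sum>t<length ys. a t * ys ! t)"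
      using True by (intro dvd_sum) (auto simp: nonzero_count_eq_0_iff)
    ultimately show ?thesis by blast
  next
    case False
    then have "3 \<le> card ?S" using c unfolding nonzero_count_conv_card by force
    then obtain T where T: "T \<subseteq> ?S" "card T = 3" by (meson obtain_subset_with_card_n)
    then obtain i j k where "T = {i, j, k}" "i \<noteq> j" "i \<noteq> k" "j \<noteq> k"
      by (auto simp: card_3_iff)
    with T show ?thesis
      by (intro weighted_sum_three_Legendre[OF p, of _ i j k]) (use e in auto)
  qed
  then obtain a where a: "\<forall>t\<in>{..<length ys}. Legendre (a t) (int p) = e t"
    "int p dvd (\<Sum>t<length ys. a t * ys ! t)" by blast
  have "\<not> int p dvd a t" if "t < length ys" for t
    using a(1) e[of t] that by (auto simp flip: Legendre_eq_0_iff)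
  with a show ?thesis by (auto simp: local_weights_def)
qed

text \<open>Either of the two nonzero positions may serve as \<open>i\<close>; this freedom is used
  to place the exception at a chosen term.\<close>

lemma local_weights_prescribed_except:
  assumes p: "prime p" "2 < p" and c: "nonzero_count p ys = 2"
    and i: "i < length ys" "\<not> int p dvd ys ! i"
    and e: "\<And>t. e t \<in> {1, -1}"
  shows "\<exists>a. local_weights p ys a \<and> (\<forall>t<length ys. t \<noteq> i \<longrightarrow> Legendre (a t) (int p) = e t)"
proof -
  let ?S = "{t. t < length ys \<and> \<not> int p dvd ys ! t}"
  obtain x y where "?S = {x, y}" "x \<noteq> y"
    using c by (auto simp: nonzero_count_conv_card card_2_iff)
  moreover have "i \<in> ?S" using i by simp
  ultimately obtain j where j: "?S = {i, j}" "i \<noteq> j" by (metis doubleton_eq_iff insertE singletonD)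
  have "j \<in> ?S" using j(1) by blast
  then have "\<exists>a. (\<forall>t\<in>{..<length ys}. \<not> int p dvd a t) \<and>
      (\<forall>t\<in>{..<length ys} - {i}. Legendre (a t) (int p) = e t) \<and> int p dvd (\<Sum>t<length ys. a t * ys ! t)"
    using i j by (intro weighted_sum_two_Legendre[OF p, of _ i j]) (use e in auto)
  then show ?thesis unfolding local_weights_def by blast
qed

lemma exists_local_weights:
  assumes p: "prime p" "7 \<le> p" and c: "nonzero_count p ys \<noteq> 1"
  shows "\<exists>a. local_weights p ys a"
proof (cases "nonzero_count p ys = 2")
  case True
  then have "card {t. t < length ys \<and> \<not> int p dvd ys ! t} \<noteq> 0"
    by (simp add: nonzero_count_conv_card)
  then have "{t. t < length ys \<and> \<not> int p dvd ys ! t} \<noteq> {}"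
    by (metis card.empty)
  then obtain i where "i < length ys" "\<not> int p dvd ys ! i" by blast
  then show ?thesis
    using local_weights_prescribed_except[of p ys i "\<lambda>_. 1"] p True by auto
next
  case False
  then show ?thesis
    using local_weights_prescribed[OF p, of ys "\<lambda>_. 1"] c by auto
qed

section \<open>Gluing local weights to weights for \<open>U(n)\<close> and
  \<open>L(n;p')\<close>\<close>

context
  fixes n :: nat
  assumes n: "1 < n" "squarefree n" "\<And>p. prime p \<Longrightarrow> p dvd n \<Longrightarrow> 7 \<le> p"
begin

private lemma pf: "p \<in> prime_factors n \<Longrightarrow> prime p \<and> p dvd n \<and> 7 \<le> p"
  using n(3) by auto

text \<open>The Chinese remainder theorem is applied at each position separately. Characters depend
  only on residues, so membership in \<open>L(n;p')\<close> can be checked on the local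
  weights.\<close>

lemma local_to_global_weights:
  assumes "\<And>p. p \<in> prime_factors n \<Longrightarrow> local_weights p ys (a p)"
  shows "\<exists>as. length as = length ys \<and> set as \<subseteq> unit_weights n \<and>
    int n dvd (\<Sum>i<length ys. as ! i * ys ! i) \<and>
    (\<forall>t<length ys. \<forall>p\<in>prime_factors n. Legendre (as ! t) (int p) = Legendre (a p t) (int p))"
proof -
  have "\<forall>t. \<exists>x\<in>{0..<int n}. \<forall>p\<in>prime_factors n. [x = a p t] (mod int p)"
    using n(1) by (intro allI prime_factors_remainder) simp
  then obtain x where x: "\<And>t. x t \<in> {0..<int n}"
    "\<And>t p. p \<in> prime_factors n \<Longrightarrow> [x t = a p t] (mod int p)" by metis
  let ?as = "map x [0..<length ys]"
  have unit: "x t \<in> unit_weights n" if t: "t < length ys" for t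
  proof -
    have "\<not> int p dvd x t" if "p \<in> prime_factors n" for p
      using assms[OF that] t cong_dvd_iff[OF x(2)[OF that]] by (auto simp: local_weights_def)
    then have c: "coprime (x t) (int n)"
      by (rule squarefree_coprimeI[OF n(2)])
    moreover have "x t \<noteq> 0" using c n(1) by auto
    ultimately show ?thesis
      using x(1)[of t] by (simp add: unit_weights_eq[OF n(1)] less_le)
  qed
  have "int p dvd (\<Sum>i<length ys. ?as ! i * ys ! i)" if p: "p \<in> prime_factors n" for p
  proof -
    have "[(\<Sum>i<length ys. ?as ! i * ys ! i) = (\<Sum>i<length ys. a p i * ys ! i)] (mod int p)"
      using x(2)[OF p] by (intro cong_sum cong_mult) auto
    then show ?thesis
      using assms[OF p] by (simp add: local_weights_def cong_dvd_iff)
  qed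
  then have "int n dvd (\<Sum>i<length ys. ?as ! i * ys ! i)"
    by (rule squarefree_dvdI[OF n(2)])
  moreover have "set ?as \<subseteq> unit_weights n" using unit by auto
  moreover have "\<forall>t<length ys. \<forall>p\<in>prime_factors n. Legendre (?as ! t) (int p) = Legendre (a p t) (int p)"
    using x(2) by (auto intro: Legendre_cong)
  ultimately show ?thesis by (intro exI[of _ ?as]) simp
qed

text \<open>A unit weight cannot annihilate a single nonzero term modulo \<open>p\<close>;
  conversely, if no prime has exactly one nonzero term, local weights exist and can be
  glued.\<close>

lemma weighted_zero_sum_unit_iff:
  "weighted_zero_sum n (unit_weights n) ys \<longleftrightarrow>
     set ys \<subseteq> carrier (ZMod n) \<and> balanced (prime_factors n) ys"
proof
  assume wz: "weighted_zero_sum n (unit_weights n) ys"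
  then obtain as where as: "length as = length ys" "set as \<subseteq> unit_weights n"
    "int n dvd (\<Sum>i<length ys. as ! i * ys ! i)" and ys: "ys \<noteq> []" "set ys \<subseteq> carrier (ZMod n)"
    by (auto simp: weighted_zero_sum_iff[OF n(1)])
  have "nonzero_count p ys \<noteq> 1" if p: "p \<in> prime_factors n" for p
  proof
    assume "nonzero_count p ys = 1"
    then obtain i where i: "{t. t < length ys \<and> \<not> int p dvd ys ! t} = {i}"
      by (auto simp: nonzero_count_conv_card card_1_singleton_iff)
    then have i1: "i < length ys" "\<not> int p dvd ys ! i" by auto
    have pn: "prime p" "int p dvd int n" using pf[OF p] by auto
    have "as ! i \<in> unit_weights n" using as i1(1) by auto
    then have "coprime (as ! i) (int n)" by (simp add: unit_weights_eq[OF n(1)])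
    then have "\<not> int p dvd as ! i"
      using pn by (meson coprime_common_divisor not_prime_unit prime_nat_int_transfer)
    then have nd: "\<not> int p dvd as ! i * ys ! i"
      using i1 pn by (simp add: prime_dvd_mult_iff)
    have "(\<Sum>t<length ys. as ! t * ys ! t) = as ! i * ys ! i + (\<Sum>t\<in>{..<length ys} - {i}. as ! t * ys ! t)"
      using i1 by (intro sum.remove) auto
    moreover have "int p dvd (\<Sum>t\<in>{..<length ys} - {i}. as ! t * ys ! t)"
      using i by (intro dvd_sum dvd_mult) auto
    moreover have "int p dvd (\<Sum>t<length ys. as ! t * ys ! t)"
      using pn(2) as(3) by (rule dvd_trans)
    ultimately show False using nd by (simp add: dvd_add_left_iff)
  qed
  then show "set ys \<subseteq> carrier (ZMod n) \<and> balanced (prime_factors n) ys"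
    using ys by (auto simp: balanced_def)
next
  assume b: "set ys \<subseteq> carrier (ZMod n) \<and> balanced (prime_factors n) ys"
  then have "\<forall>p\<in>prime_factors n. \<exists>a. local_weights p ys a"
    using exists_local_weights pf by (auto simp: balanced_def)
  then obtain a where "\<And>p. p \<in> prime_factors n \<Longrightarrow> local_weights p ys (a p)" by metis
  from local_to_global_weights[OF this] b
  show "weighted_zero_sum n (unit_weights n) ys"
    by (auto simp: weighted_zero_sum_iff[OF n(1)] balanced_def)
qed

text \<open>The factor at \<open>r\<close> is nonzero and cancels in the defining equation. The
  characters of weights in \<open>L(n;r)\<close> are thus constrained only at the other
  primes.\<close>

lemma L_weights_iff:
  assumes "r \<in> prime_factors n"
  shows "x \<in> L_weights n r \<longleftrightarrow>
    x \<in> unit_weights n \<and> (\<Prod>p\<in>prime_factors n - {r}. Legendre x (int p)) = 1"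
proof (cases "x \<in> unit_weights n")
  case True
  then have "coprime x (int n)" by (simp add: unit_weights_eq[OF n(1)])
  then have "\<not> int r dvd x"
    using pf[OF assms] by (meson coprime_common_divisor int_dvd_int_iff not_prime_unit prime_nat_int_transfer)
  then have "Legendre x (int r) \<noteq> 0" by (simp add: Legendre_eq_0_iff)
  moreover have "Jacobi x n = Legendre x (int r) * (\<Prod>p\<in>prime_factors n - {r}. Legendre x (int p))"
    unfolding Jacobi_squarefree[OF n(2)] using assms by (intro prod.remove) auto
  ultimately show ?thesis using True by (simp add: L_weights_def)
qed (simp add: L_weights_def)

lemma weighted_zero_sum_L_of_local:
  assumes r: "r \<in> prime_factors n" and ys: "ys \<noteq> []" "set ys \<subseteq> carrier (ZMod n)"
    and a: "\<And>p. p \<in> prime_factors n \<Longrightarrow> local_weights p ys (a p)"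
    and one: "\<And>t. t < length ys \<Longrightarrow> (\<Prod>p\<in>prime_factors n - {r}. Legendre (a p t) (int p)) = 1"
  shows "weighted_zero_sum n (L_weights n r) ys"
proof -
  obtain as where as: "length as = length ys" "set as \<subseteq> unit_weights n"
    "int n dvd (\<Sum>i<length ys. as ! i * ys ! i)"
    "\<And>t p. t < length ys \<Longrightarrow> p \<in> prime_factors n \<Longrightarrow> Legendre (as ! t) (int p) = Legendre (a p t) (int p)"
    using local_to_global_weights[OF a] by blast
  have "as ! t \<in> L_weights n r" if t: "t < length ys" for t
    using as one[OF t] t by (auto simp: L_weights_iff[OF r])
  then have "set as \<subseteq> L_weights n r" using as(1) by (auto simp: in_set_conv_nth)
  then show ?thesis using ys as by (auto simp: weighted_zero_sum_iff[OF n(1)])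
qed

private lemma rest_sign:
  assumes "\<And>p. p \<in> Q \<Longrightarrow> local_weights p ys (a p)" "t < length ys"
  shows "(\<Prod>p\<in>Q. Legendre (a p t) (int p)) \<in> {1, -1}"
  using assms
proof (induction Q rule: infinite_finite_induct)
  case (insert p Q)
  then have "Legendre (a p t) (int p) \<in> {1, -1}"
    by (intro Legendre_sign) (auto simp: local_weights_def)
  moreover have "(\<Prod>p\<in>Q. Legendre (a p t) (int p)) \<in> {1, -1}"
    using insert by auto
  ultimately show ?case using insert.hyps by auto
qed auto

text \<open>At \<open>q\<close> the count is 0 or at least 3, so the characters there can be
  prescribed at every position: choose weights arbitrarily at the other primes and let
  \<open>q\<close> correct the product.\<close>

lemma weighted_zero_sum_L_of_count:
  assumes r: "r \<in> prime_factors n" and ys: "set ys \<subseteq> carrier (ZMod n)" "balanced (prime_factors n) ys"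
    and q: "q \<in> prime_factors n - {r}" "nonzero_count q ys \<noteq> 2"
  shows "weighted_zero_sum n (L_weights n r) ys"
proof -
  have "\<forall>p\<in>prime_factors n. \<exists>a. local_weights p ys a"
    using exists_local_weights pf ys by (auto simp: balanced_def)
  then obtain a where a: "\<And>p. p \<in> prime_factors n \<Longrightarrow> local_weights p ys (a p)" by metis
  let ?R = "prime_factors n - {r} - {q}"
  \<comment> \<open>\<open>e t\<close> is the product of the remaining characters, so the same sign
    at \<open>q\<close> makes the full product 1. The value 1 past the end makes \<open>e\<close> a
    sign everywhere, as \<open>local_weights_prescribed\<close> requires.\<close>
  define e where "e t = (if t < length ys then \<Prod>p\<in>?R. Legendre (a p t) (int p) else 1)" for t
  have e: "e t \<in> {1, -1}" for t
    using rest_sign[of ?R ys a t] a by (auto simp: e_def)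
  have "nonzero_count q ys \<notin> {1, 2}" using ys q by (auto simp: balanced_def)
  then obtain b where b: "local_weights q ys b" "\<And>t. t < length ys \<Longrightarrow> Legendre (b t) (int q) = e t"
    using local_weights_prescribed[of q ys e] pf q e by blast
  show ?thesis
  proof (rule weighted_zero_sum_L_of_local[OF r _ ys(1), where a = "a(q := b)"])
    show "ys \<noteq> []" using ys by (simp add: balanced_def)
    show "local_weights p ys ((a(q := b)) p)" if "p \<in> prime_factors n" for p
      using a b that by auto
    fix t assume t: "t < length ys"
    have "(\<Prod>p\<in>prime_factors n - {r}. Legendre ((a(q := b)) p t) (int p)) =
        Legendre (b t) (int q) * (\<Prod>p\<in>?R. Legendre ((a(q := b)) p t) (int p))"
      using q(1) by (subst prod.remove[of _ q]) auto
    also have "(\<Prod>p\<in>?R. Legendre ((a(q := b)) p t) (int p)) = e t"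
      using t unfolding e_def by (auto intro: prod.cong)
    also have "Legendre (b t) (int q) = e t" by (rule b(2)[OF t])
    also have "e t * e t = 1" using e[of t] by auto
    finally show "(\<Prod>p\<in>prime_factors n - {r}. Legendre ((a(q := b)) p t) (int p)) = 1" .
  qed
qed

text \<open>The weights at \<open>q'\<close> correct every character except the one at the position of \<open>y\<close>;
  that one is corrected at \<open>q\<close>, where the weight of \<open>y\<close> is free.\<close>

lemma weighted_zero_sum_L_of_dvd:
  assumes r: "r \<in> prime_factors n" and ys: "set ys \<subseteq> carrier (ZMod n)" "balanced (prime_factors n) ys"
    and q: "q \<in> prime_factors n - {r}" and q': "q' \<in> prime_factors n - {r}" "nonzero_count q' ys = 2"
    and y: "y \<in> set ys" "int q dvd y" "\<not> int q' dvd y"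
  shows "weighted_zero_sum n (L_weights n r) ys"
proof -
  obtain i where i: "i < length ys" "ys ! i = y" using y(1) by (auto simp: in_set_conv_nth)
  have ne: "q \<noteq> q'" using y by auto
  have "\<forall>p\<in>prime_factors n. \<exists>a. local_weights p ys a"
    using exists_local_weights pf ys by (auto simp: balanced_def)
  then obtain a where a: "\<And>p. p \<in> prime_factors n \<Longrightarrow> local_weights p ys (a p)" by metis
  let ?R = "prime_factors n - {r} - {q'}" and ?T = "prime_factors n - {r} - {q}"
  define e where "e t = (if t < length ys then \<Prod>p\<in>?R. Legendre (a p t) (int p) else 1)" for t
  have e: "e t \<in> {1, -1}" for t
    using rest_sign[of ?R ys a t] a by (auto simp: e_def)
  obtain b where b: "local_weights q' ys b"
    "\<And>t. t < length ys \<Longrightarrow> t \<noteq> i \<Longrightarrow> Legendre (b t) (int q') = e t"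
  proof -
    have "prime q'" "2 < q'" using pf[of q'] q'(1) by auto
    from local_weights_prescribed_except[OF this q'(2) i(1), of e] i(2) y(3) e that
    show thesis by blast
  qed
  define a2 where "a2 = a(q' := b)"
  have a2: "local_weights p ys (a2 p)" if "p \<in> prime_factors n" for p
    using a b that by (auto simp: a2_def)
  \<comment> \<open>After the correction at \<open>q'\<close> only the product at position
    \<open>i\<close> can be wrong; \<open>d\<close> is the sign required at \<open>q\<close>
    there.\<close>
  define d where "d = (\<Prod>p\<in>?T. Legendre (a2 p i) (int p))"
  have d: "d \<in> {1, -1}" unfolding d_def using a2 i by (intro rest_sign) auto
  have qp: "prime q" "2 < q" using pf[of q] q by auto
  obtain c where c: "Legendre c (int q) = d"
    using exists_Legendre_eq[OF qp d] by blast
  \<comment> \<open>Since \<open>q\<close> divides \<open>ys ! i\<close>, replacing its weight by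
    \<open>c\<close> does not change the sum modulo \<open>q\<close>.\<close>
  define a3 where "a3 = a2(q := (a2 q)(i := c))"
  have "\<not> int q dvd c" using c d by (auto simp flip: Legendre_eq_0_iff)
  moreover have "int q dvd (\<Sum>t<length ys. a3 q t * ys ! t)"
  proof -
    have "[(\<Sum>t<length ys. a3 q t * ys ! t) = (\<Sum>t<length ys. a2 q t * ys ! t)] (mod int q)"
    proof (rule cong_sum)
      fix t
      show "[a3 q t * ys ! t = a2 q t * ys ! t] (mod int q)"
        using i y by (cases "t = i") (auto simp: a3_def cong_iff_dvd_diff)
    qed
    then show ?thesis using a2[of q] q by (simp add: local_weights_def cong_dvd_iff)
  qed
  ultimately have "local_weights q ys (a3 q)"
    using a2[of q] q by (auto simp: local_weights_def a3_def)
  then have a3: "local_weights p ys (a3 p)" if "p \<in> prime_factors n" for p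
    using a2[OF that] by (cases "p = q") (auto simp: a3_def)
  show ?thesis
  proof (rule weighted_zero_sum_L_of_local[OF r _ ys(1) a3])
    show "ys \<noteq> []" using ys by (simp add: balanced_def)
    fix t assume t: "t < length ys"
    show "(\<Prod>p\<in>prime_factors n - {r}. Legendre (a3 p t) (int p)) = 1"
    proof (cases "t = i")
      case True
      have "(\<Prod>p\<in>prime_factors n - {r}. Legendre (a3 p t) (int p)) =
          Legendre (a3 q t) (int q) * (\<Prod>p\<in>?T. Legendre (a3 p t) (int p))"
        using q by (intro prod.remove) auto
      also have "(\<Prod>p\<in>?T. Legendre (a3 p t) (int p)) = d"
        unfolding d_def True by (intro prod.cong) (auto simp: a3_def)
      also have "Legendre (a3 q t) (int q) = d" using c True by (simp add: a3_def)
      also have "d * d = 1" using d by auto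
      finally show ?thesis .
    next
      case False
      have "(\<Prod>p\<in>prime_factors n - {r}. Legendre (a3 p t) (int p)) =
          Legendre (a3 q' t) (int q') * (\<Prod>p\<in>?R. Legendre (a3 p t) (int p))"
        using q' by (intro prod.remove) auto
      also have "(\<Prod>p\<in>?R. Legendre (a3 p t) (int p)) = e t"
      proof -
        have "Legendre (a3 p t) (int p) = Legendre (a p t) (int p)" if "p \<in> ?R" for p
          using that False by (auto simp: a3_def a2_def)
        then show ?thesis using t by (simp add: e_def)
      qed
      also have "Legendre (a3 q' t) (int q') = e t"
        using b(2)[OF t False] ne by (simp add: a3_def a2_def)
      also have "e t * e t = 1" using e[of t] by auto
      finally show ?thesis .
    qed
  qed
qed

text \<open>In the absence of zero-sum sublists for \<open>L(n;r)\<close>,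
  \<open>weighted_zero_sum_L_of_count\<close> and \<open>weighted_zero_sum_L_of_dvd\<close> supply
  the hypotheses \<open>two\<close> and \<open>same\<close> of
  \<open>no_balanced_sublist\<close>.\<close>

lemma no_weighted_zero_sum:
  assumes r: "r \<in> prime_factors n" and k: "3 \<le> card (prime_factors n)"
    and ys: "set ys \<subseteq> carrier (ZMod n)" "2 ^ card (prime_factors n) - 1 \<le> length ys"
    and no: "\<not> has_consecutive_zero_sum n (L_weights n r) ys"
  shows "\<not> has_consecutive_zero_sum n (unit_weights n) ys"
proof
  assume "has_consecutive_zero_sum n (unit_weights n) ys"
  then obtain zs where zs: "sublist zs ys" "weighted_zero_sum n (unit_weights n) zs"
    by (auto simp: has_consecutive_zero_sum_def)
  have no': "\<not> weighted_zero_sum n (L_weights n r) ws" "set ws \<subseteq> carrier (ZMod n)" if "sublist ws ys" for ws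
    using no that ys(1) set_mono_sublist[OF that] by (auto simp: has_consecutive_zero_sum_def)
  have "\<not> balanced (prime_factors n) zs"
  proof (rule no_balanced_sublist[OF _ r k ys(2) _ _ zs(1)])
    show two: "nonzero_count q ws = 2"
      if "sublist ws ys" "balanced (prime_factors n) ws" "q \<in> prime_factors n - {r}" for ws q
      using no'[OF that(1)] weighted_zero_sum_L_of_count[OF r _ that(2,3)] by blast
    show "int q' dvd y"
      if "sublist ws ys" "balanced (prime_factors n) ws" "q \<in> prime_factors n - {r}"
        "q' \<in> prime_factors n - {r}" "y \<in> set ws" "int q dvd y" for ws q q' y
      using no'[OF that(1)] weighted_zero_sum_L_of_dvd[OF r _ that(2-4) two[OF that(1,2,4)] that(5,6)]
      by blast
  qed simp
  then show False using zs(2) weighted_zero_sum_unit_iff by blast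
qed

section \<open>Values of the constants for \<open>U(n)\<close> and \<open>L(n;p')\<close>\<close>

lemma has_consecutive_zero_sum_unit:
  assumes "set ys \<subseteq> carrier (ZMod n)" "2 ^ card (prime_factors n) \<le> length ys"
  shows "has_consecutive_zero_sum n (unit_weights n) ys"
proof -
  obtain zs where zs: "sublist zs ys" "balanced (prime_factors n) zs"
    using exists_balanced_sublist[of "prime_factors n" ys] assms(2) by auto
  moreover have "set zs \<subseteq> carrier (ZMod n)" using assms(1) set_mono_sublist[OF zs(1)] by blast
  ultimately show ?thesis
    using weighted_zero_sum_unit_iff unfolding has_consecutive_zero_sum_def by blast
qed

text \<open>Reducing the terms modulo \<open>n\<close> preserves divisibility by its prime divisors,
  so the doubling construction can be carried into the ring.\<close>

lemma exists_list_without_zero_sum: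
  "\<exists>ys. length ys = 2 ^ card (prime_factors n) - 1 \<and> set ys \<subseteq> carrier (ZMod n) \<and>
    \<not> has_consecutive_zero_sum n (unit_weights n) ys"
proof -
  interpret residues "int n" "ZMod n" by unfold_locales (use n in auto)
  obtain xs where xs: "length xs = 2 ^ card (prime_factors n) - 1"
    "\<And>zs. sublist zs xs \<Longrightarrow> \<not> balanced (prime_factors n) zs"
    using exists_list_without_balanced_sublist[of "prime_factors n"] by auto
  let ?ys = "map (\<lambda>x. x mod int n) xs"
  have "\<not> weighted_zero_sum n (unit_weights n) zs" if zs: "sublist zs ?ys" for zs
  proof -
    from sublist_map_rightE[OF zs] obtain ws where ws: "sublist ws xs" "zs = map (\<lambda>x. x mod int n) ws"
      by blast
    have "nonzero_count p zs = nonzero_count p ws" if "p \<in> prime_factors n" for p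
    proof -
      have "int p dvd x mod int n \<longleftrightarrow> int p dvd x" for x
        using pf[OF that] by (intro dvd_mod_iff) simp
      then show ?thesis unfolding ws(2) by (induction ws) auto
    qed
    then have "\<not> balanced (prime_factors n) zs"
      using xs(2)[OF ws(1)] ws(2) by (auto simp: balanced_def)
    then show ?thesis by (simp add: weighted_zero_sum_unit_iff)
  qed
  then have "\<not> has_consecutive_zero_sum n (unit_weights n) ?ys"
    by (auto simp: has_consecutive_zero_sum_def)
  moreover have "set ?ys \<subseteq> carrier (ZMod n)" using n(1) by (auto simp: res_carrier_eq)
  ultimately show ?thesis using xs(1) by (intro exI[of _ ?ys]) simp
qed

text \<open>Serves \<open>U(n)\<close> and \<open>L(n;p')\<close> alike: the lower bound is
  inherited from \<open>U(n)\<close>, since fewer weights give fewer zero-sum sequences.\<close>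

lemma C_const_eq:
  assumes "A \<subseteq> unit_weights n"
    and "\<And>ys. set ys \<subseteq> carrier (ZMod n) \<Longrightarrow> length ys = 2 ^ card (prime_factors n) \<Longrightarrow>
      has_consecutive_zero_sum n A ys"
  shows "C_const n A = 2 ^ card (prime_factors n)"
  unfolding C_const_def
proof (rule Least_equality)
  show "0 < (2::nat) ^ card (prime_factors n) \<and> (\<forall>ys. length ys = 2 ^ card (prime_factors n) \<and>
      set ys \<subseteq> carrier (ZMod n) \<longrightarrow> has_consecutive_zero_sum n A ys)"
    using assms(2) by simp
next
  fix k
  assume k: "0 < k \<and> (\<forall>ys. length ys = k \<and> set ys \<subseteq> carrier (ZMod n) \<longrightarrow> has_consecutive_zero_sum n A ys)"
  show "2 ^ card (prime_factors n) \<le> k"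
  proof (rule ccontr)
    assume lt: "\<not> 2 ^ card (prime_factors n) \<le> k"
    obtain ys where ys: "length ys = 2 ^ card (prime_factors n) - 1" "set ys \<subseteq> carrier (ZMod n)"
      "\<not> has_consecutive_zero_sum n (unit_weights n) ys"
      using exists_list_without_zero_sum by blast
    \<comment> \<open>A smaller \<open>k\<close> would force a zero-sum sublist in the prefix of
      length \<open>k\<close>, and this is also one of the whole list.\<close>
    have "length (take k ys) = k" using ys(1) lt by simp
    moreover have "set (take k ys) \<subseteq> carrier (ZMod n)" using set_take_subset[of k ys] ys(2) by (rule order_trans)
    ultimately have "has_consecutive_zero_sum n A (take k ys)" using k by simp
    then have "has_consecutive_zero_sum n A ys"
      unfolding has_consecutive_zero_sum_def using sublist_order.order.trans[OF _ sublist_take] by blast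
    then show False using ys(3) has_consecutive_zero_sum_mono[OF assms(1)] by blast
  qed
qed

end

theorem theorem7p2:
  fixes n p' :: nat and ys :: "int list"
  assumes "n > 0" and "squarefree n"
    and "\<And>p. prime p \<Longrightarrow> p dvd n \<Longrightarrow> 7 \<le> p"
    and "prime p'" and "p' dvd n"
    and "card (prime_factors n) \<noteq> 2"
  shows "C_extremal n (L_weights n p') ys \<longleftrightarrow> C_extremal n (unit_weights n) ys"
proof -
  have r: "p' \<in> prime_factors n" using assms by (simp add: prime_factors_dvd)
  have n1: "1 < n"
    using prime_gt_1_nat[OF assms(4)] dvd_imp_le[OF assms(5,1)] by simp
  note facts = n1 assms(2,3)
  have sub: "L_weights n p' \<subseteq> unit_weights n" by (auto simp: L_weights_def)
  have pos: "0 < card (prime_factors n)" using r by (auto simp: card_gt_0_iff)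
  show ?thesis
  proof (cases "card (prime_factors n) = 1")
    case True
    \<comment> \<open>With a single prime divisor the product over the others is empty, so by
      \<open>L_weights_iff\<close> every unit is a weight.\<close>
    then have "prime_factors n = {p'}" using r by (auto simp: card_1_singleton_iff)
    then have "L_weights n p' = unit_weights n"
      using L_weights_iff[OF facts r] by auto
    then show ?thesis by simp
  next
    case False
    then have k: "3 \<le> card (prime_factors n)" using pos assms(6) by linarith
    have U: "C_const n (unit_weights n) = 2 ^ card (prime_factors n)"
      using has_consecutive_zero_sum_unit[OF facts] by (intro C_const_eq[OF facts]) auto
    have L: "C_const n (L_weights n p') = 2 ^ card (prime_factors n)"
    \<comment> \<open>A list of this length always has a zero-sum sublist for \<open>U(n)\<close>,
      hence one for \<open>L(n;p')\<close> by the contrapositive of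
      \<open>no_weighted_zero_sum\<close>.\<close>
    proof (rule C_const_eq[OF facts sub])
      fix ys
      assume "set ys \<subseteq> carrier (ZMod n)" "length ys = 2 ^ card (prime_factors n)"
      then show "has_consecutive_zero_sum n (L_weights n p') ys"
        using no_weighted_zero_sum[OF facts r k, of ys] has_consecutive_zero_sum_unit[OF facts, of ys] by auto
    qed
    \<comment> \<open>Both constants agree, and extremal sequences have exactly the least length
      covered by \<open>no_weighted_zero_sum\<close>; the other direction is monotonicity in the
      weights.\<close>
    show ?thesis
      unfolding C_extremal_def U L
      using no_weighted_zero_sum[OF facts r k, of ys] has_consecutive_zero_sum_mono[OF sub] by auto
  qed
qed

end
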